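(* Let $n\ge 6$ and let $s\in(0,1)$ be such that $k_0 := 1+\sum_{k=1}^{n-1}\frac{1}{1+k^s}$ is an integer. Then the sequence $\{A_{n,k}(s)\}_{k}$ has a peak at $k_0$, i.e. $k_0$ is its unique mode (unique index at which the maximum over $k$ is attained). Moreover, the set of integers $k_0$ arising in this way from some $s\in(0,1)$ is exactly the set of integers strictly between $H_n$ and $\frac{n+1}{2}$, where $H_n=\sum_{j=1}^n 1/j$.
   Context: For $s\in\mathbb{R}$ define polynomials $P_n^{h_s}(x)$ recursively by $P_0^{h_s}(x):=1$ and, for $n\ge 1$, $P_n^{h_s}(x) := \frac{x}{n^s}\sum_{k=0}^{n-1} P_k^{h_s}(x)$, and write $P_n^{h_s}(x)=\sum_{k=0}^n A_{n,k}(s)\,x^k$. *)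

theory Defs
  imports "HOL-Analysis.Harmonic_Numbers" "HOL-Computational_Algebra.Polynomial"
begin

fun P :: "real \<Rightarrow> nat \<Rightarrow> real poly" where
  "P s n = (if n = 0 then 1
            else smult (1 / real n powr s) (monom 1 1 * (\<Sum>k\<in>{0..<n}. P s k)))"

declare P.simps [simp del]

definition A :: "nat \<Rightarrow> nat \<Rightarrow> real \<Rightarrow> real" where
  "A n k s = coeff (P s n) k"

definition k0 :: "nat \<Rightarrow> real \<Rightarrow> real" where
  "k0 n s = 1 + (\<Sum>k=1..n-1. 1 / (1 + real k powr s))"

definition modes :: "nat \<Rightarrow> (nat \<Rightarrow> real) \<Rightarrow> nat set" where
  "modes n a = {k. is_arg_max a (\<lambda>j. j \<le> n) k}"

definition has_peak_at :: "nat \<Rightarrow> (nat \<Rightarrow> real) \<Rightarrow> nat \<Rightarrow> bool" where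
  "has_peak_at n a k \<longleftrightarrow> modes n a = {k}"

end

theory Submission
  imports Defs
begin

text \<open>
  The recursion telescopes to \<open>P s n = x / (n!)\<^sup>s * F\<close> with \<open>F = (\<Prod>k=1..n-1. k\<^sup>s + x)\<close>, so the claim
  is Darroch's theorem on the mode of a Poisson-binomial distribution with integer mean.
  For \<open>F = (\<Prod>i\<in>I. a i + x)\<close>, \<open>F\<^sub>i = F / (a i + x)\<close> and \<open>\<mu> = (\<Sum>i\<in>I. 1 / (1 + a i))\<close> one has
  \<open>(\<Sum>i\<in>I. a i / (1 + a i) * (x - 1) * F\<^sub>i) = x * F' - \<mu> * F\<close>. If \<open>\<mu> = m\<close> is an integer, the \<open>m\<close>-th
  coefficient of the right-hand side vanishes, so \<open>coeff F\<^sub>i (m-1) \<ge> coeff F\<^sub>i m\<close> for some \<open>i\<close> and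
  \<open>coeff F\<^sub>j (m-1) \<le> coeff F\<^sub>j m\<close> for some \<open>j\<close>. By strict log-concavity of the \<open>F\<^sub>i\<close>,
  the former gives \<open>coeff F m > coeff F (m+1)\<close> and the latter \<open>coeff F m > coeff F (m-1)\<close>.
  The range of \<open>k\<^sub>0\<close> follows from its continuity and strict monotonicity in \<open>s\<close>.
\<close>

section \<open>Strictly log-concave coefficient sequences\<close>

text \<open>\<open>N\<close> plays the role of the degree. For \<open>k = N - 1\<close> the last
  clause only compares 0 with the square of the positive leading coefficient.\<close>

definition strict_logconcave :: "real poly \<Rightarrow> nat \<Rightarrow> bool" where
  "strict_logconcave p N \<longleftrightarrow>
     (\<forall>k\<le>N. 0 < coeff p k) \<and> (\<forall>k>N. coeff p k = 0) \<and>
     (\<forall>k<N. coeff p k * coeff p (k + 2) < (coeff p (k + 1))\<^sup>2)"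

lemma coeff_linear_mult_0: "coeff ([:a, 1:] * p) 0 = a * coeff p 0"
  and coeff_linear_mult_Suc: "coeff ([:a, 1:] * p) (Suc k) = a * coeff p (Suc k) + coeff p k"
  for a :: "'a::comm_semiring_1"
  by simp_all

text \<open>Expand the new log-concavity gap in powers of \<open>a\<close>: the coefficients of
  \<open>a^2\<close> and \<open>a^0\<close> are gaps of \<open>p\<close> at adjacent indices, that
  of \<open>a\<close> is a cross term. All are nonnegative, and the \<open>a^0\<close> part gives
  strictness.\<close>

lemma strict_logconcave_linear_mult:
  assumes p: "strict_logconcave p N" and a: "0 < a"
  shows "strict_logconcave ([:a, 1:] * p) (Suc N)"
proof -
  let ?c = "coeff p"
  define d where "d = coeff ([:a, 1:] * p)"
  have d_0: "d 0 = a * ?c 0" and d_Suc: "d (Suc k) = a * ?c (Suc k) + ?c k" for k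
    unfolding d_def by (rule coeff_linear_mult_0 coeff_linear_mult_Suc)+
  have pos: "0 < ?c k" if "k \<le> N" for k using p that by (simp add: strict_logconcave_def)
  have zero: "?c k = 0" if "k > N" for k using p that by (simp add: strict_logconcave_def)
  have nonneg: "0 \<le> ?c k" for k using pos[of k] zero[of k] by (cases "k \<le> N") auto
  have lc: "?c k * ?c (k + 2) < (?c (k + 1))\<^sup>2" if "k < N" for k
    using p that by (simp add: strict_logconcave_def)
  have lc': "?c k * ?c (k + 2) \<le> (?c (k + 1))\<^sup>2" for k
    using lc[of k] zero[of "k + 2"] by (cases "k < N") auto
  \<comment> \<open>Multiply the inequalities at two adjacent indices and cancel the common positive
    factor \<open>?t\<close>.\<close>
  have cross: "?c k * ?c (k + 3) \<le> ?c (k + 1) * ?c (k + 2)" for k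
  proof (cases "k + 2 \<le> N")
    case True
    let ?t = "?c (k + 1) * ?c (k + 2)"
    have t: "0 < ?t" using pos[of "k + 1"] pos[of "k + 2"] True by simp
    have "(?c k * ?c (k + 2)) * (?c (k + 1) * ?c (k + 3)) \<le> (?c (k + 1))\<^sup>2 * (?c (k + 2))\<^sup>2"
      using lc'[of k] lc'[of "k + 1"] nonneg by (intro mult_mono) (auto simp: numeral_3_eq_3)
    then have "(?c k * ?c (k + 3)) * ?t \<le> ?t * ?t"
      by (simp add: power2_eq_square mult_ac)
    then show ?thesis using t by (simp only: mult_le_cancel_right_pos)
  next
    case False
    then show ?thesis using zero[of "k + 3"] nonneg by simp
  qed
  have "0 < d k" if "k \<le> Suc N" for k
  proof (cases k)
    case 0
    then show ?thesis using a pos[of 0] by (simp add: d_0)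
  next
    case (Suc l)
    then have "0 \<le> a * ?c (Suc l)" "0 < ?c l" using a nonneg pos[of l] that by auto
    then show ?thesis unfolding Suc d_Suc by linarith
  qed
  moreover have "d k = 0" if "k > Suc N" for k
  proof (cases k)
    case (Suc l)
    then show ?thesis using that zero unfolding Suc d_Suc by simp
  qed (use that in simp)
  moreover have "d k * d (k + 2) < (d (k + 1))\<^sup>2" if "k < Suc N" for k
  proof (cases k)
    \<comment> \<open>This is the general expansion below with the coefficient at index -1 read as
      0.\<close>
    case 0
    have "0 \<le> a\<^sup>2 * ((?c 1)\<^sup>2 - ?c 0 * ?c 2)"
      using lc'[of 0] by (simp add: numeral_2_eq_2)
    moreover have "0 \<le> a * ?c 0 * ?c 1" using a nonneg by simp
    moreover have "0 < (?c 0)\<^sup>2" using pos[of 0] by simp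
    moreover have "(a * ?c 1 + ?c 0)\<^sup>2 - a * ?c 0 * (a * ?c 2 + ?c 1) =
        a\<^sup>2 * ((?c 1)\<^sup>2 - ?c 0 * ?c 2) + a * ?c 0 * ?c 1 + (?c 0)\<^sup>2"
      by algebra
    ultimately have "a * ?c 0 * (a * ?c 2 + ?c 1) < (a * ?c 1 + ?c 0)\<^sup>2" by linarith
    then show ?thesis by (simp add: 0 d_0 d_Suc numeral_2_eq_2)
  next
    case (Suc l)
    have "0 \<le> a\<^sup>2 * ((?c (l + 2))\<^sup>2 - ?c (l + 1) * ?c (l + 3))"
      using lc'[of "l + 1"] by (simp add: numeral_3_eq_3)
    moreover have "0 < (?c (l + 1))\<^sup>2 - ?c l * ?c (l + 2)"
      using lc[of l] that Suc by simp
    moreover have "0 \<le> a * (?c (l + 1) * ?c (l + 2) - ?c l * ?c (l + 3))"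
      using a cross[of l] by simp
    moreover have "(a * ?c (l + 2) + ?c (l + 1))\<^sup>2 -
          (a * ?c (l + 1) + ?c l) * (a * ?c (l + 3) + ?c (l + 2)) =
        a\<^sup>2 * ((?c (l + 2))\<^sup>2 - ?c (l + 1) * ?c (l + 3)) + ((?c (l + 1))\<^sup>2 - ?c l * ?c (l + 2)) +
        a * (?c (l + 1) * ?c (l + 2) - ?c l * ?c (l + 3))"
      by algebra
    moreover have "d k = a * ?c (l + 1) + ?c l" "d (k + 1) = a * ?c (l + 2) + ?c (l + 1)"
        "d (k + 2) = a * ?c (l + 3) + ?c (l + 2)"
      using d_Suc[of l] d_Suc[of "l + 1"] d_Suc[of "l + 2"] Suc by (simp_all add: numeral_3_eq_3)
    ultimately show ?thesis by simp
  qed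
  ultimately show ?thesis unfolding strict_logconcave_def d_def by blast
qed

lemma strict_logconcave_prod_linear:
  assumes "finite I" "\<And>i. i \<in> I \<Longrightarrow> 0 < a i"
  shows "strict_logconcave (\<Prod>i\<in>I. [:a i, 1:]) (card I)"
  using assms
proof (induction I rule: finite_induct)
  case empty
  then show ?case by (simp add: strict_logconcave_def)
next
  case (insert i I)
  then show ?case using strict_logconcave_linear_mult[of _ "card I" "a i"] by simp
qed

text \<open>Ratios of consecutive coefficients strictly decrease, so a ratio of at most 1 is
  followed by one below 1.\<close>

lemma strict_logconcave_decreasing:
  assumes "strict_logconcave p N" "k < N" "coeff p (k + 1) \<le> coeff p k"
  shows "coeff p (k + 2) < coeff p (k + 1)"
proof -
  have c: "0 < coeff p (k + 1)" "coeff p k * coeff p (k + 2) < (coeff p (k + 1))\<^sup>2"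
    "0 \<le> coeff p (k + 2)"
    using assms(1,2) unfolding strict_logconcave_def
    by (auto, metis le_less_linear less_eq_real_def)
  have "coeff p (k + 1) * coeff p (k + 2) \<le> coeff p k * coeff p (k + 2)"
    using assms(3) c(3) by (rule mult_right_mono)
  with c(2) have "coeff p (k + 1) * coeff p (k + 2) < coeff p (k + 1) * coeff p (k + 1)"
    by (simp add: power2_eq_square)
  with c(1) show ?thesis by (simp only: mult_less_cancel_left_pos)
qed

lemma strict_logconcave_increasing:
  assumes "strict_logconcave p N" "k < N" "coeff p (k + 1) \<le> coeff p (k + 2)"
  shows "coeff p k < coeff p (k + 1)"
proof (rule ccontr)
  assume "\<not> ?thesis"
  then show False using strict_logconcave_decreasing[OF assms(1,2)] assms(3) by simp
qed

text \<open>A strict local maximum is global: descent propagates to the right and ascent to the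
  left, and beyond \<open>N\<close> the coefficients vanish.\<close>

lemma strict_logconcave_peak:
  assumes p: "strict_logconcave p N"
    and m: "m < N" "coeff p (m + 1) < coeff p m"
    and m': "0 < m" "coeff p (m - 1) < coeff p m"
    and "j \<noteq> m"
  shows "coeff p j < coeff p m"
proof -
  \<comment> \<open>The first conjunct drives the induction, the second is the comparison
    wanted.\<close>
  have up: "coeff p (m + d + 1) < coeff p (m + d) \<and> coeff p (m + d + 1) < coeff p m"
    if "m + d < N" for d
    using that
  proof (induction d)
    case 0
    then show ?case using m by simp
  next
    case (Suc d)
    then show ?case using strict_logconcave_decreasing[OF p, of "m + d"] by simp
  qed
  have down: "coeff p (m - d - 1) < coeff p (m - d) \<and> coeff p (m - d - 1) < coeff p m"
    if "d < m" for d
    using that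
  proof (induction d)
    case 0
    then show ?case using m' by simp
  next
    case (Suc d)
    \<comment> \<open>Turns the truncated subtractions into sums:
      \<open>m - Suc d - 1 = e\<close>.\<close>
    then obtain e where e: "m = d + e + 2" using less_imp_Suc_add[of "Suc d" m] by auto
    have "coeff p (e + 1) < coeff p (e + 2) \<and> coeff p (e + 1) < coeff p m"
      using Suc.IH e by simp
    moreover have "coeff p e < coeff p (e + 1)"
      using strict_logconcave_increasing[OF p, of e] calculation e m(1) by simp
    ultimately show ?case using e by simp
  qed
  consider "j < m" | "m < j" "j \<le> N" | "N < j" using \<open>j \<noteq> m\<close> by linarith
  then show ?thesis
  proof cases
    case 1
    then show ?thesis using down[of "m - j - 1"] by simp
  next
    case 2
    then show ?thesis using up[of "j - m - 1"] by simp
  next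
    case 3
    then show ?thesis using p m(1) by (simp add: strict_logconcave_def)
  qed
qed

section \<open>Darroch's theorem for integer means\<close>

text \<open>For a single factor, \<open>a / (1 + a) * (x - 1) = x - (a + x) / (1 + a)\<close>.
  Multiply by the remaining factors and sum; the product rule turns the first terms into the
  derivative.\<close>

lemma prod_linear_mean_identity:
  fixes a :: "'i \<Rightarrow> real"
  assumes "finite I" "\<And>i. i \<in> I \<Longrightarrow> 0 < a i"
  defines "F \<equiv> \<lambda>J. \<Prod>i\<in>J. [:a i, 1:]"
  shows "(\<Sum>i\<in>I. smult (a i / (1 + a i)) ([:-1, 1:] * F (I - {i}))) =
         monom 1 1 * pderiv (F I) - smult (\<Sum>i\<in>I. 1 / (1 + a i)) (F I)"
proof -
  have "smult (a i / (1 + a i)) ([:-1, 1:] * F (I - {i})) =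
      monom 1 1 * F (I - {i}) - smult (1 / (1 + a i)) (F I)" if "i \<in> I" for i
  proof -
    have F: "F I = [:a i, 1:] * F (I - {i})"
      unfolding F_def using assms(1) that by (rule prod.remove)
    have "1 + a i \<noteq> 0" using assms(2)[OF that] by simp
    then have "smult (a i / (1 + a i)) [:-1, 1:] = monom 1 1 - smult (1 / (1 + a i)) [:a i, 1:]"
      by (simp add: monom_Suc field_simps flip: one_pCons)
    then show ?thesis unfolding F by (metis left_diff_distrib mult_smult_left)
  qed
  then have "(\<Sum>i\<in>I. smult (a i / (1 + a i)) ([:-1, 1:] * F (I - {i}))) =
      (\<Sum>i\<in>I. monom 1 1 * F (I - {i}) - smult (1 / (1 + a i)) (F I))"
    by (rule sum.cong[OF refl])
  also have "\<dots> = monom 1 1 * (\<Sum>i\<in>I. F (I - {i})) - smult (\<Sum>i\<in>I. 1 / (1 + a i)) (F I)"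
    by (simp add: sum_subtractf sum_distrib_left smult_sum)
  also have "(\<Sum>i\<in>I. F (I - {i})) = pderiv (F I)"
    by (simp add: F_def pderiv_prod pderiv_pCons)
  finally show ?thesis .
qed

text \<open>Divided by their sum, the coefficients are the distribution of a sum of independent
  Bernoulli variables with success probabilities \<open>1 / (1 + a i)\<close>; \<open>m\<close> is
  its mean.\<close>

theorem prod_linear_peak_at_mean:
  fixes a :: "'i \<Rightarrow> real"
  assumes I: "finite I" "I \<noteq> {}" and a: "\<And>i. i \<in> I \<Longrightarrow> 0 < a i"
    and mean: "(\<Sum>i\<in>I. 1 / (1 + a i)) = real m"
    and neq: "j \<noteq> m"
  shows "coeff (\<Prod>i\<in>I. [:a i, 1:]) j < coeff (\<Prod>i\<in>I. [:a i, 1:]) m"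
proof -
  define F where "F J = (\<Prod>i\<in>J. [:a i, 1:])" for J
  have "0 < (\<Sum>i\<in>I. 1 / (1 + a i))"
    using I a by (intro sum_pos) (auto intro: add_pos_pos)
  then have m_pos: "0 < m" using mean by simp
  have "(\<Sum>i\<in>I. 1 / (1 + a i)) < (\<Sum>i\<in>I. 1)"
    using I a by (intro sum_strict_mono) (auto simp: field_simps add_pos_pos)
  then have m_less: "m < card I" using mean by simp
  then obtain l where l: "m = Suc l" using m_pos by (cases m) auto
  have slc: "strict_logconcave (F I) (card I)"
    unfolding F_def using I(1) a by (rule strict_logconcave_prod_linear)
  have slc': "strict_logconcave (F (I - {i})) (card I - 1)" if "i \<in> I" for i
    using strict_logconcave_prod_linear[of "I - {i}" a] I(1) a that by (simp add: F_def)
  have F: "F I = [:a i, 1:] * F (I - {i})" if "i \<in> I" for i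
    unfolding F_def using I(1) that by (rule prod.remove)
  \<comment> \<open>\<open>D i\<close> is the coefficient of \<open>x^m\<close> in
    \<open>(x - 1) * F (I - {i})\<close>.\<close>
  define D where "D i = coeff (F (I - {i})) l - coeff (F (I - {i})) (Suc l)" for i
  have "(\<Sum>i\<in>I. a i / (1 + a i) * D i) =
      coeff (\<Sum>i\<in>I. smult (a i / (1 + a i)) ([:-1, 1:] * F (I - {i}))) (Suc l)"
    by (simp only: coeff_sum coeff_smult coeff_linear_mult_Suc D_def) (simp add: algebra_simps)
  also have "\<dots> = coeff (monom 1 1 * pderiv (F I) - smult (real m) (F I)) (Suc l)"
    using prod_linear_mean_identity[OF I(1) a] mean by (simp add: F_def)
  \<comment> \<open>Integrality of the mean enters here: \<open>x * F'\<close> multiplies the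
    coefficient at index \<open>m\<close> by exactly \<open>m\<close>.\<close>
  also have "\<dots> = 0"
    by (simp add: coeff_monom_mult coeff_pderiv l)
  finally have balance: "(\<Sum>i\<in>I. a i / (1 + a i) * D i) = 0" .
  have w: "0 < a i / (1 + a i)" if "i \<in> I" for i using a[OF that] by simp
  \<comment> \<open>A vanishing sum with positive weights cannot have only negative terms, nor (for
    \<open>h\<close>) only positive ones.\<close>
  obtain i where i: "i \<in> I" "0 \<le> D i"
  proof (rule ccontr)
    assume "\<not> thesis"
    then have "D i < 0" if "i \<in> I" for i using that \<open>\<And>i. \<lbrakk>i \<in> I; 0 \<le> D i\<rbrakk> \<Longrightarrow> thesis\<close> by force
    then have "(\<Sum>i\<in>I. a i / (1 + a i) * D i) < (\<Sum>i\<in>I. 0)"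
      using I w by (intro sum_strict_mono mult_pos_neg) auto
    then show False using balance by simp
  qed
  obtain h where h: "h \<in> I" "D h \<le> 0"
  proof (rule ccontr)
    assume "\<not> thesis"
    then have "0 < D i" if "i \<in> I" for i using that \<open>\<And>i. \<lbrakk>i \<in> I; D i \<le> 0\<rbrakk> \<Longrightarrow> thesis\<close> by force
    then have "0 < (\<Sum>i\<in>I. a i / (1 + a i) * D i)"
      using I w by (intro sum_pos mult_pos_pos) auto
    then show False using balance by simp
  qed
  \<comment> \<open>Restore the factor \<open>a i + x\<close> and compare both summands of the
    coefficients separately; one comparison is strict.\<close>
  have "coeff (F I) (m + 1) < coeff (F I) m"
  proof -
    let ?c = "coeff (F (I - {i}))"
    have "?c (l + 2) < ?c (l + 1)"
      using strict_logconcave_decreasing[OF slc'[OF i(1)], of l] i(2) m_less l by (simp add: D_def)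
    then have "a i * ?c (Suc (Suc l)) < a i * ?c (Suc l)" using a[OF i(1)] by simp
    moreover have "?c (Suc l) \<le> ?c l" using i(2) by (simp add: D_def)
    ultimately show ?thesis
      unfolding F[OF i(1)] l Suc_eq_plus1[symmetric] coeff_linear_mult_Suc by linarith
  qed
  moreover have "coeff (F I) (m - 1) < coeff (F I) m"
  proof -
    let ?c = "coeff (F (I - {h}))"
    have le: "?c l \<le> ?c (Suc l)" using h(2) by (simp add: D_def)
    then have le': "a h * ?c l \<le> a h * ?c (Suc l)" using a[OF h(1)] by simp
    show ?thesis
    proof (cases l)
      \<comment> \<open>For \<open>m = 1\<close> the lower coefficient is just
        \<open>a h * ?c 0\<close>, and strictness comes from \<open>?c 0 > 0\<close>.\<close>
      case 0
      have "0 < ?c 0" using slc'[OF h(1)] by (simp add: strict_logconcave_def)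
      then show ?thesis
        using le' unfolding F[OF h(1)] l 0 diff_Suc_1 coeff_linear_mult_Suc coeff_linear_mult_0
        by linarith
    next
      case (Suc r)
      have "?c r < ?c (r + 1)"
        using strict_logconcave_increasing[OF slc'[OF h(1)], of r] le m_less l Suc by simp
      then show ?thesis
        using le' unfolding F[OF h(1)] l Suc diff_Suc_1 coeff_linear_mult_Suc by simp
    qed
  qed
  ultimately show ?thesis
    using strict_logconcave_peak[OF slc m_less _ m_pos _ neq] by (simp add: F_def)
qed

section \<open>The polynomials \<open>P\<close> and the mean \<open>k0\<close>\<close>

text \<open>The recursion for \<open>P s (Suc n)\<close> expresses \<open>x\<close> times its sum
  through \<open>P s (Suc n)\<close> itself, so each further step multiplies by a single linear
  factor and a scalar. The index starts at 1 because \<open>P s 0 = 1\<close> lacks the factor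
  \<open>x\<close>.\<close>

lemma P_eq_prod:
  "P s (Suc n) = smult (1 / fact (Suc n) powr s) (monom 1 1 * (\<Prod>k\<in>{1..n}. [:real k powr s, 1:]))"
proof (induction n)
  case 0
  then show ?case by (simp add: P.simps[of s "Suc 0"] P.simps[of s 0])
next
  case (Suc n)
  let ?S = "\<Sum>k\<in>{0..<Suc n}. P s k"
  have n: "real (Suc n) powr s \<noteq> 0" by simp
  have S: "P s (Suc n) = smult (1 / real (Suc n) powr s) (monom 1 1 * ?S)"
    by (subst P.simps) simp
  have S': "monom 1 1 * ?S = smult (real (Suc n) powr s) (P s (Suc n))"
    unfolding S using n by simp
  have "P s (Suc (Suc n)) = smult (1 / real (Suc (Suc n)) powr s) (monom 1 1 * (?S + P s (Suc n)))"
    by (subst P.simps) simp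
  also have "monom 1 1 * (?S + P s (Suc n)) = [:real (Suc n) powr s, 1:] * P s (Suc n)"
    unfolding distrib_left S' by (simp add: monom_Suc mult_pCons_left)
  finally have "P s (Suc (Suc n)) =
      smult (1 / real (Suc (Suc n)) powr s) ([:real (Suc n) powr s, 1:] * P s (Suc n))" .
  moreover have "fact (Suc (Suc n)) powr s = real (Suc (Suc n)) powr s * fact (Suc n) powr s"
    by (subst fact_Suc) (rule powr_mult; simp)
  ultimately show ?case
    unfolding Suc.IH by (simp add: mult_ac del: fact_Suc mult_pCons_left mult_pCons_right)
qed

lemma A_Suc:
  "A (Suc n) (Suc k) s = coeff (\<Prod>i\<in>{1..n}. [:real i powr s, 1:]) k / fact (Suc n) powr s"
  and A_0: "A (Suc n) 0 s = 0"
  by (simp_all add: A_def P_eq_prod coeff_monom_mult del: fact_Suc)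

lemma has_peak_atI:
  assumes "k \<le> n" "\<And>j. j \<le> n \<Longrightarrow> j \<noteq> k \<Longrightarrow> a j < a k"
  shows "has_peak_at n a k"
proof -
  have "is_arg_max a (\<lambda>j. j \<le> n) i \<longleftrightarrow> i = k" for i
    unfolding is_arg_max_def using assms by (metis less_asym order_less_irrefl)
  then show ?thesis by (simp add: has_peak_at_def modes_def)
qed

text \<open>The product with \<open>a k = k^s\<close> has mean \<open>k0 n s - 1\<close>; the extra
  factor \<open>x\<close> of \<open>P\<close> moves its peak up by one.\<close>

lemma A_peak_at_k0:
  assumes "2 \<le> n" "k0 n s \<in> \<int>"
  shows "\<exists>k. real k = k0 n s \<and> has_peak_at n (\<lambda>j. A n j s) k"
proof -
  obtain N where N: "n = Suc N" "1 \<le> N" using assms(1) by (cases n) auto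
  let ?\<mu> = "\<Sum>k\<in>{1..N}. 1 / (1 + real k powr s)"
  have k0: "k0 n s = 1 + ?\<mu>" by (simp add: k0_def N)
  have "0 \<le> ?\<mu>" by (intro sum_nonneg) auto
  moreover have "?\<mu> \<in> \<int>" using Ints_diff[OF assms(2) Ints_1] k0 by simp
  ultimately have "?\<mu> \<in> \<nat>" by (simp add: Nats_altdef2)
  then obtain m where m: "?\<mu> = real m" by (rule Nats_cases)
  have lt: "coeff (\<Prod>i\<in>{1..N}. [:real i powr s, 1:]) j < coeff (\<Prod>i\<in>{1..N}. [:real i powr s, 1:]) m"
    if "j \<noteq> m" for j
    using N(2) m that by (intro prod_linear_peak_at_mean) auto
  have "real m \<le> (\<Sum>k\<in>{1..N}. 1)"
    unfolding m[symmetric] by (intro sum_mono) (simp add: add_pos_nonneg)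
  then have "m \<le> N" by simp
  have "has_peak_at n (\<lambda>j. A n j s) (Suc m)"
  proof (rule has_peak_atI)
    show "Suc m \<le> n" using \<open>m \<le> N\<close> N by simp
    fix j assume j: "j \<noteq> Suc m"
    have f: "0 < (fact (Suc N) :: real) powr s" by (simp del: fact_Suc)
    show "A n j s < A n (Suc m) s"
    proof (cases j)
      \<comment> \<open>Index 0 lies outside the shifted product, so its zero coefficient is
        compared with a positive one.\<close>
      case 0
      have "0 < coeff (\<Prod>i\<in>{1..N}. [:real i powr s, 1:]) m"
        using strict_logconcave_prod_linear[of "{1..N}" "\<lambda>i. real i powr s"] \<open>m \<le> N\<close>
        by (simp add: strict_logconcave_def)
      then show ?thesis unfolding 0 N A_0 A_Suc using f by (rule divide_pos_pos)
    next
      case (Suc i)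
      then have "i \<noteq> m" using j by simp
      from lt[OF this] f show ?thesis unfolding Suc N A_Suc by (rule divide_strict_right_mono)
    qed
  qed
  then show ?thesis using k0 m by (intro exI[of _ "Suc m"]) simp
qed

section \<open>The range of \<open>k0\<close> over the open unit interval\<close>

lemma k0_strict_antimono:
  assumes "3 \<le> n" "s < t"
  shows "k0 n t < k0 n s"
proof -
  have "(\<Sum>k=1..n-1. 1 / (1 + real k powr t)) < (\<Sum>k=1..n-1. 1 / (1 + real k powr s))"
  proof (rule sum_strict_mono_ex1)
    show "\<forall>k\<in>{1..n-1}. 1 / (1 + real k powr t) \<le> 1 / (1 + real k powr s)"
      using assms(2) by (auto intro!: divide_left_mono add_pos_nonneg mult_pos_pos powr_mono)
    \<comment> \<open>The term at \<open>k = 1\<close> is constantly 1/2, so strictness is taken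
      from \<open>k = 2\<close>, which is in range as \<open>3 \<le> n\<close>.\<close>
    show "\<exists>k\<in>{1..n-1}. 1 / (1 + real k powr t) < 1 / (1 + real k powr s)"
      using assms by (intro bexI[of _ 2]) (auto intro!: divide_strict_left_mono add_pos_nonneg mult_pos_pos)
  qed simp
  then show ?thesis by (simp add: k0_def)
qed

lemma continuous_on_k0: "continuous_on S (k0 n)"
  unfolding k0_def
  by (intro continuous_intros) (auto simp: add_nonneg_eq_0_iff)

lemma k0_0: "1 \<le> n \<Longrightarrow> k0 n 0 = (real n + 1) / 2"
  by (simp add: k0_def of_nat_diff field_simps)

lemma k0_1:
  assumes "1 \<le> n"
  shows "k0 n 1 = harm n"
proof -
  obtain N where "n = Suc N" using assms by (cases n) auto
  moreover have "harm (Suc N) = 1 + (\<Sum>k=1..N. 1 / (1 + real k))"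
  proof (induction N)
    case 0
    then show ?case by (simp add: harm_def)
  next
    case (Suc N)
    then show ?case by (subst harm_Suc) (simp add: inverse_eq_divide)
  qed
  ultimately show ?thesis by (simp add: k0_def)
qed

text \<open>Strict monotonicity keeps the values strictly between those at the endpoints 1 and 0;
  the intermediate value theorem shows that all of them occur.\<close>

lemma k0_image:
  assumes "3 \<le> n"
  shows "k0 n ` {0<..<1} = {harm n<..<(real n + 1) / 2}"
proof
  have ends: "k0 n 0 = (real n + 1) / 2" "k0 n 1 = harm n" using k0_0 k0_1 assms by auto
  show "k0 n ` {0<..<1} \<subseteq> {harm n<..<(real n + 1) / 2}"
    using k0_strict_antimono[OF assms] by (auto simp flip: ends)
  show "{harm n<..<(real n + 1) / 2} \<subseteq> k0 n ` {0<..<1}"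
  proof
    fix x assume x: "x \<in> {harm n<..<(real n + 1) / 2}"
    then obtain s where s: "0 \<le> s" "s \<le> 1" "k0 n s = x"
      using IVT2'[of "k0 n" 1 x 0] continuous_on_k0 ends by force
    moreover from s x ends have "s \<noteq> 0" "s \<noteq> 1" by auto
    ultimately show "x \<in> k0 n ` {0<..<1}" by force
  qed
qed

theorem theorem4:
  fixes n :: nat
  assumes "n \<ge> 6"
  shows "(\<forall>s::real. 0 < s \<and> s < 1 \<and> k0 n s \<in> \<int> \<longrightarrow>
            (\<exists>k::nat. real k = k0 n s \<and> has_peak_at n (\<lambda>j. A n j s) k))
       \<and> {m::int. \<exists>s::real. 0 < s \<and> s < 1 \<and> k0 n s = real_of_int m}
         = {m::int. harm n < real_of_int m \<and> real_of_int m < (real n + 1) / 2}"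
proof (intro conjI allI impI)
  fix s :: real assume "0 < s \<and> s < 1 \<and> k0 n s \<in> \<int>"
  then show "\<exists>k::nat. real k = k0 n s \<and> has_peak_at n (\<lambda>j. A n j s) k"
    using A_peak_at_k0 assms by simp
next
  have "(\<exists>s. 0 < s \<and> s < 1 \<and> k0 n s = x) \<longleftrightarrow> x \<in> k0 n ` {0<..<1}" for x
    by auto
  then show "{m::int. \<exists>s::real. 0 < s \<and> s < 1 \<and> k0 n s = real_of_int m}
      = {m::int. harm n < real_of_int m \<and> real_of_int m < (real n + 1) / 2}"
    using k0_image assms by simp
qed

end
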